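(* Let $(P,q)$ be a Datalog LITEM query, i.e., $P$ is a Datalog LITEM program and $q$ a predicate. Then $(P,q)$ is satisfiable if and only if $q$ is satisfiable w.r.t. the guarded generalized program $P\cup F_P$, where $F_P\equiv\{\,q'(\mathbf{X})\vee\mathrm{not}\,q'(\mathbf{X})\leftarrow\ \mid q'\text{ extensional (but not }=)\text{ in }P\,\}$. Moreover, this reduction is linear (the size of $P\cup F_P$ is linear in the size of $P$).
   Context: **Generalized programs and open answer sets.** Terms are constants and variables (no function symbols). A literal is an atom $q(\mathbf{t})$ or a naf-atom $\mathrm{not}\,q(\mathbf{t})$. Equality is a binary predicate; $t\neq s$ stands for $\mathrm{not}\,(t=s)$. A regular atom is an atom that is not an equality atom; $q$ is a predicate of $P$ other than equality. A generalized literal is $\forall\mathbf{Y}.\,\phi\Rightarrow\psi$ with $\phi$ a boolean combination of atoms and $\psi$ an atom. For a set $\beta$ of literals and generalized literals, $\beta^{\mathrm{x}}$ is its set of generalized literals, $\beta^+$ its set of atoms, $\beta^-=\{a\mid\mathrm{not}\,a\in\beta\}$. A rule of a generalized program (gP) is $\alpha\leftarrow\beta$, with $\alpha$ a finite set of literals with $|\alpha^+|\le1$ and no equality atom in $\alpha^+$, and $\beta$ a finite set of literals and generalized literals; a gP is a finite set of rules. A universe $U$ for $P$ is a non-empty countable superset of the constants of $P$; $P_U$ is obtained by substituting the (free) variables of rules by elements of $U$ in all possible ways. For a set $I$ of ground regular atoms, $I\models a$ iff $a\in I$ for regular $a$; $I\models t=s$ iff $t,s$ are the same element; $I\models\mathrm{not}\,a$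 iff $I\not\models a$; boolean combinations as usual. The GeLi-reduct $Q^{\mathrm{x}(U,I)}$ of a ground program $Q$ consists of the rules $\alpha\leftarrow(\beta\setminus\beta^{\mathrm{x}}),\ \bigcup_{\forall\mathbf{Y}.\phi\Rightarrow\psi\,\in\,\beta^{\mathrm{x}}}\{\psi[\mathbf{Y}|\mathbf{y}]\mid\mathbf{y}\subseteq U,\ I\models\phi[\mathbf{Y}|\mathbf{y}]\}$ for $\alpha\leftarrow\beta\in Q$. For a ground program $Q$ without generalized literals, $Q^I=\{\alpha^+\leftarrow\beta^+\mid\alpha\leftarrow\beta\in Q,\ I\models\mathrm{not}\,\beta^-,\ I\models\alpha^-\}$ (every element of $\alpha^-$ true and every element of $\beta^-$ false in $I$), and $I$ is an answer set of $Q$ if it is a subset-minimal model of $Q^I$. An open answer set of $P$ is a pair $(U,M)$, $U$ a universe for $P$, $M$ a set of ground regular atoms over the predicates of $P$ and $U$, with $M$ an answer set of $(P_U)^{\mathrm{x}(U,M)}$. $q$ is satisfiable w.r.t. $P$ if some open answer set $(U,M)$ of $P$ has some $q(\mathbf{x})\in M$. A free rule is $q(\mathbf{t})\vee\mathrm{not}\,q(\mathbf{t})\leftarrow$. A generalized literal $\forall\mathbf{Y}.\phi\Rightarrow\psi$ is guarded if $\phi$ is of the form $\gamma\wedge\phi'$ with $\gamma$ an atom containing all variables of $\mathbf{Y},\phi',\psi$. A rule $\alpha\leftarrow\beta$ is guarded if all its generalized literals are guarded and some atom in $\beta^+$ contains all free variables of the rule. A guarded gP (GgP) is a gP all of whose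 non-free rules are guarded. **Datalog LITEM.** A Datalog LITE generalized literal is $\forall\mathbf{Y}.\,a\Rightarrow b$ with $a,b$ atoms and $\mathrm{vars}(b)\subseteq\mathrm{vars}(a)$ (quantified variables not occurring in $a$ are dropped from the quantifier). A Datalog rule is $a\leftarrow\beta$ with head a single regular atom, $\beta$ a finite set of literals and Datalog LITE generalized literals. A basic Datalog program is a finite set of Datalog rules in which no head predicate occurs in a negative body or in the antecedent of a generalized literal. Predicates occurring only in bodies are extensional; equality is always extensional; $\mathrm{edb}(P)$ is the set of extensional predicates. A stratified program is a union of basic programs $(P_1,\dots,P_n)$ such that each head predicate of $P$ is a head predicate in exactly one $P_i$, and if a head predicate in $P_i$ is extensional in $P_j$ then $i<j$. A Datalog LITEM program is a stratified program with Datalog LITE generalized literals in which every rule has an atom in its positive body that contains all free variables of the rule. An input structure $\mathcal{U}$ for $P$ is a relational structure over the extensional predicates of $P$, with non-empty countable domain $U$ containing the constants of $P$ and equality interpreted as identity; it is identified with its set of true ground atoms. $\mathcal{U}_0=\mathcal{U}$ and $\mathcal{U}_i=\mathcal{U}_{i-1}\cup S_i$, with $S_i$ the minimal model (over $U$) of the first-order clauses corresponding to $P_i$ among those models whose restriction to $\mathrm{edb}(P_i)$ equals $\mathcal{U}_{i-1}|\mathrm{edb}(P_i)$, a generalized literal $\forall\mathbf{Y}.a\Rightarrow b$ being instantiated (per grounding of its free variables) by the conjunction of the $b[\mathbf{Y}|\mathbf{y}]$ for which $a[\mathbf{Y}|\mathbf{y}]$ is true. The least fixed point model is $\mathcal{U}_n$.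 A query $(P,q)$ is satisfiable if for some input structure $\mathcal{U}$ the least fixed point model contains some $q(\mathbf{a})$. *)

theory Defs
  imports Complex_Main "HOL-Library.Countable_Set" "HOL-Library.Infinite_Typeclass"
begin

section \<open>Syntax\<close>

text \<open>
  Constants and the elements of universes are drawn from the same type \<open>'c\<close>, so that a universe
  is literally a superset of the constants of a program and ground terms are of the form
  \<open>Const c\<close>. For universes to range over all countable sets up to isomorphism, \<open>'c\<close> has to be
  infinite. Predicate symbols are drawn from \<open>'p\<close>; their arities are given by a function
  \<open>ar\<close>. Equality is not an element of \<open>'p\<close> but a separate atom constructor.
\<close>

datatype 'c trm = Var nat | Const 'c

datatype ('p, 'c) atom = Reg 'p "'c trm list" | Eq "'c trm" "'c trm"

datatype 'a literal = Pos 'a | Naf 'a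

datatype 'a bform =
    Atm 'a
  | Neg "'a bform"
  | Conj "'a bform" "'a bform"
  | Disj "'a bform" "'a bform"

text \<open>\<open>GenLit Y \<phi> \<psi>\<close> is the generalized literal \<open>\<forall>Y. \<phi> \<Rightarrow> \<psi>\<close>.\<close>

datatype ('p, 'c) genlit = GenLit "nat list" "('p, 'c) atom bform" "('p, 'c) atom"

text \<open>
  In a rule \<open>\<alpha> \<leftarrow> \<beta>\<close>, the head \<open>\<alpha>\<close> is \<open>head\<close>, and \<open>\<beta>\<close> is the disjoint union of its ordinary
  literals \<open>lits\<close> and its generalized literals \<open>gens\<close>. Finiteness is imposed in the definition of
  programs and not here, since GeLi-reducts may have rules with infinite bodies.
\<close>

datatype ('p, 'c) rule =
  Rule (head: "('p, 'c) atom literal set")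
       (lits: "('p, 'c) atom literal set")
       (gens: "('p, 'c) genlit set")

type_synonym ('p, 'c) program = "('p, 'c) rule set"

definition pos :: "'a literal set \<Rightarrow> 'a set" where
  "pos L = {a. Pos a \<in> L}"

definition neg :: "'a literal set \<Rightarrow> 'a set" where
  "neg L = {a. Naf a \<in> L}"

fun genlit_atoms :: "('p, 'c) genlit \<Rightarrow> ('p, 'c) atom set" where
  "genlit_atoms (GenLit Y \<phi> \<psi>) = insert \<psi> (set_bform \<phi>)"

fun antecedent_atoms :: "('p, 'c) genlit \<Rightarrow> ('p, 'c) atom set" where
  "antecedent_atoms (GenLit Y \<phi> \<psi>) = set_bform \<phi>"

definition rule_atoms :: "('p, 'c) rule \<Rightarrow> ('p, 'c) atom set" where
  "rule_atoms r = \<Union> (set_literal ` (head r \<union> lits r)) \<union> \<Union> (genlit_atoms ` gens r)"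

definition prog_atoms :: "('p, 'c) program \<Rightarrow> ('p, 'c) atom set" where
  "prog_atoms P = \<Union> (rule_atoms ` P)"

fun atom_terms :: "('p, 'c) atom \<Rightarrow> 'c trm set" where
  "atom_terms (Reg p ts) = set ts"
| "atom_terms (Eq s t) = {s, t}"

definition atom_vars :: "('p, 'c) atom \<Rightarrow> nat set" where
  "atom_vars a = {x. Var x \<in> atom_terms a}"

definition prog_consts :: "('p, 'c) program \<Rightarrow> 'c set" where
  "prog_consts P = {c. \<exists>a \<in> prog_atoms P. Const c \<in> atom_terms a}"

text \<open>Predicates of a set of atoms and of a program, other than equality.\<close>

definition atoms_preds :: "('p, 'c) atom set \<Rightarrow> 'p set" where
  "atoms_preds A = {p. \<exists>ts. Reg p ts \<in> A}"

definition preds :: "('p, 'c) program \<Rightarrow> 'p set" where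
  "preds P = atoms_preds (prog_atoms P)"

fun genlit_fv :: "('p, 'c) genlit \<Rightarrow> nat set" where
  "genlit_fv (GenLit Y \<phi> \<psi>) = (\<Union> (atom_vars ` set_bform \<phi>) \<union> atom_vars \<psi>) - set Y"

definition rule_fv :: "('p, 'c) rule \<Rightarrow> nat set" where
  "rule_fv r =
     \<Union> (atom_vars ` \<Union> (set_literal ` (head r \<union> lits r))) \<union> \<Union> (genlit_fv ` gens r)"

fun wf_atom :: "('p \<Rightarrow> nat) \<Rightarrow> ('p, 'c) atom \<Rightarrow> bool" where
  "wf_atom ar (Reg p ts) \<longleftrightarrow> length ts = ar p"
| "wf_atom ar (Eq s t) \<longleftrightarrow> True"


section \<open>Grounding and truth\<close>

type_synonym 'c sbst = "nat \<rightharpoonup> 'c"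

fun subst_trm :: "'c sbst \<Rightarrow> 'c trm \<Rightarrow> 'c trm" where
  "subst_trm \<sigma> (Var x) = (case \<sigma> x of None \<Rightarrow> Var x | Some c \<Rightarrow> Const c)"
| "subst_trm \<sigma> (Const c) = Const c"

fun subst_atom :: "'c sbst \<Rightarrow> ('p, 'c) atom \<Rightarrow> ('p, 'c) atom" where
  "subst_atom \<sigma> (Reg p ts) = Reg p (map (subst_trm \<sigma>) ts)"
| "subst_atom \<sigma> (Eq s t) = Eq (subst_trm \<sigma> s) (subst_trm \<sigma> t)"

text \<open>Only the free occurrences of variables are replaced.\<close>

fun subst_genlit :: "'c sbst \<Rightarrow> ('p, 'c) genlit \<Rightarrow> ('p, 'c) genlit" where
  "subst_genlit \<sigma> (GenLit Y \<phi> \<psi>) =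
     (let \<tau> = \<sigma> |` (- set Y) in GenLit Y (map_bform (subst_atom \<tau>) \<phi>) (subst_atom \<tau> \<psi>))"

definition subst_rule :: "'c sbst \<Rightarrow> ('p, 'c) rule \<Rightarrow> ('p, 'c) rule" where
  "subst_rule \<sigma> r =
     Rule (map_literal (subst_atom \<sigma>) ` head r)
          (map_literal (subst_atom \<sigma>) ` lits r)
          (subst_genlit \<sigma> ` gens r)"

definition groundings :: "'c set \<Rightarrow> nat set \<Rightarrow> 'c sbst set" where
  "groundings U X = {\<sigma>. dom \<sigma> = X \<and> ran \<sigma> \<subseteq> U}"

text \<open>The ground program \<open>P\<^sub>U\<close>.\<close>

definition ground :: "'c set \<Rightarrow> ('p, 'c) program \<Rightarrow> ('p, 'c) program" where
  "ground U P = (\<Union>r\<in>P. (\<lambda>\<sigma>. subst_rule \<sigma> r) ` groundings U (rule_fv r))"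

text \<open>
  An interpretation is a set of ground regular atoms. Truth is only meant to be applied to ground
  atoms; two ground terms denote the same element iff they are identical.
\<close>

type_synonym ('p, 'c) interp = "('p, 'c) atom set"

fun sat :: "('p, 'c) interp \<Rightarrow> ('p, 'c) atom \<Rightarrow> bool" where
  "sat I (Reg p ts) \<longleftrightarrow> Reg p ts \<in> I"
| "sat I (Eq s t) \<longleftrightarrow> s = t"

fun sat_literal :: "('p, 'c) interp \<Rightarrow> ('p, 'c) atom literal \<Rightarrow> bool" where
  "sat_literal I (Pos a) \<longleftrightarrow> sat I a"
| "sat_literal I (Naf a) \<longleftrightarrow> \<not> sat I a"

fun sat_bform :: "('p, 'c) interp \<Rightarrow> ('p, 'c) atom bform \<Rightarrow> bool" where
  "sat_bform I (Atm a) \<longleftrightarrow> sat I a"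
| "sat_bform I (Neg \<phi>) \<longleftrightarrow> \<not> sat_bform I \<phi>"
| "sat_bform I (Conj \<phi> \<psi>) \<longleftrightarrow> sat_bform I \<phi> \<and> sat_bform I \<psi>"
| "sat_bform I (Disj \<phi> \<psi>) \<longleftrightarrow> sat_bform I \<phi> \<or> sat_bform I \<psi>"

text \<open>The set \<open>{\<psi>[Y|y] | y \<subseteq> U, I \<Turnstile> \<phi>[Y|y]}\<close> for a generalized literal \<open>\<forall>Y. \<phi> \<Rightarrow> \<psi>\<close>.\<close>

fun genlit_inst :: "'c set \<Rightarrow> ('p, 'c) interp \<Rightarrow> ('p, 'c) genlit \<Rightarrow> ('p, 'c) atom set" where
  "genlit_inst U I (GenLit Y \<phi> \<psi>) =
     {subst_atom \<theta> \<psi> | \<theta>. \<theta> \<in> groundings U (set Y) \<and> sat_bform I (map_bform (subst_atom \<theta>) \<phi>)}"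

definition ground_atoms :: "('p \<Rightarrow> nat) \<Rightarrow> 'p set \<Rightarrow> 'c set \<Rightarrow> ('p, 'c) atom set" where
  "ground_atoms ar Q U =
     {Reg p (map Const cs) | p cs. p \<in> Q \<and> length cs = ar p \<and> set cs \<subseteq> U}"

definition minimal_in :: "'a set set \<Rightarrow> 'a set \<Rightarrow> bool" where
  "minimal_in \<C> M \<longleftrightarrow> M \<in> \<C> \<and> (\<forall>N\<in>\<C>. N \<subseteq> M \<longrightarrow> N = M)"

definition universe :: "('p, 'c) program \<Rightarrow> 'c set \<Rightarrow> bool" where
  "universe P U \<longleftrightarrow> U \<noteq> {} \<and> countable U \<and> prog_consts P \<subseteq> U"


section \<open>Generalized programs and open answer sets\<close>

definition gP :: "('p \<Rightarrow> nat) \<Rightarrow> ('p, 'c) program \<Rightarrow> bool" where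
  "gP ar P \<longleftrightarrow> finite P \<and> (\<forall>a\<in>prog_atoms P. wf_atom ar a) \<and>
     (\<forall>r\<in>P. finite (head r) \<and> finite (lits r) \<and> finite (gens r) \<and>
        card (pos (head r)) \<le> 1 \<and> (\<forall>s t. Eq s t \<notin> pos (head r)))"

definition geli_reduct ::
    "'c set \<Rightarrow> ('p, 'c) interp \<Rightarrow> ('p, 'c) program \<Rightarrow> ('p, 'c) program" where
  "geli_reduct U I Q =
     (\<lambda>r. Rule (head r) (lits r \<union> Pos ` \<Union> (genlit_inst U I ` gens r)) {}) ` Q"

text \<open>
  The reduct \<open>Q\<^sup>I\<close> of a ground program without generalized literals; a pair \<open>(A, B)\<close> stands for
  the rule \<open>A \<leftarrow> B\<close>.
\<close>

definition reduct ::
    "('p, 'c) program \<Rightarrow> ('p, 'c) interp \<Rightarrow> (('p, 'c) atom set \<times> ('p, 'c) atom set) set" where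
  "reduct Q I =
     {(pos (head r), pos (lits r)) | r. r \<in> Q \<and>
        (\<forall>a\<in>neg (lits r). \<not> sat I a) \<and> (\<forall>a\<in>neg (head r). sat I a)}"

definition reduct_model ::
    "('p, 'c) interp \<Rightarrow> (('p, 'c) atom set \<times> ('p, 'c) atom set) set \<Rightarrow> bool" where
  "reduct_model J R \<longleftrightarrow> (\<forall>(A, B)\<in>R. (\<forall>b\<in>B. sat J b) \<longrightarrow> (\<exists>a\<in>A. sat J a))"

definition answer_set :: "('p, 'c) program \<Rightarrow> ('p, 'c) interp \<Rightarrow> bool" where
  "answer_set Q I \<longleftrightarrow> minimal_in {J. reduct_model J (reduct Q I)} I"

definition open_answer_set ::
    "('p \<Rightarrow> nat) \<Rightarrow> ('p, 'c) program \<Rightarrow> 'c set \<Rightarrow> ('p, 'c) interp \<Rightarrow> bool" where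
  "open_answer_set ar P U M \<longleftrightarrow> universe P U \<and> M \<subseteq> ground_atoms ar (preds P) U \<and>
     answer_set (geli_reduct U M (ground U P)) M"

definition satisfiable :: "('p \<Rightarrow> nat) \<Rightarrow> ('p, 'c) program \<Rightarrow> 'p \<Rightarrow> bool" where
  "satisfiable ar P q \<longleftrightarrow> (\<exists>U M ts. open_answer_set ar P U M \<and> Reg q ts \<in> M)"

definition free_rule :: "('p, 'c) rule \<Rightarrow> bool" where
  "free_rule r \<longleftrightarrow> (\<exists>p ts. r = Rule {Pos (Reg p ts), Naf (Reg p ts)} {} {})"

text \<open>
  The antecedent of a guarded generalized literal is \<open>\<gamma> \<and> \<phi>'\<close>, where \<open>\<phi>'\<close> may be the empty
  conjunction, i.e. the antecedent may consist of the guard \<open>\<gamma>\<close> alone.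
\<close>

fun guarded_genlit :: "('p, 'c) genlit \<Rightarrow> bool" where
  "guarded_genlit (GenLit Y \<phi> \<psi>) \<longleftrightarrow>
     (\<exists>\<gamma>. (\<phi> = Atm \<gamma> \<or> (\<exists>\<phi>'. \<phi> = Conj (Atm \<gamma>) \<phi>')) \<and>
          set Y \<union> \<Union> (atom_vars ` set_bform \<phi>) \<union> atom_vars \<psi> \<subseteq> atom_vars \<gamma>)"

definition has_guard :: "('p, 'c) rule \<Rightarrow> bool" where
  "has_guard r \<longleftrightarrow> (\<exists>a\<in>pos (lits r). rule_fv r \<subseteq> atom_vars a)"

definition guarded_rule :: "('p, 'c) rule \<Rightarrow> bool" where
  "guarded_rule r \<longleftrightarrow> (\<forall>g\<in>gens r. guarded_genlit g) \<and> has_guard r"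

definition ggP :: "('p \<Rightarrow> nat) \<Rightarrow> ('p, 'c) program \<Rightarrow> bool" where
  "ggP ar P \<longleftrightarrow> gP ar P \<and> (\<forall>r\<in>P. \<not> free_rule r \<longrightarrow> guarded_rule r)"


section \<open>Datalog LITEM\<close>

fun lite_genlit :: "('p, 'c) genlit \<Rightarrow> bool" where
  "lite_genlit (GenLit Y \<phi> b) \<longleftrightarrow>
     (\<exists>a. \<phi> = Atm a \<and> atom_vars b \<subseteq> atom_vars a \<and> set Y \<subseteq> atom_vars a)"

definition datalog_rule :: "('p \<Rightarrow> nat) \<Rightarrow> ('p, 'c) rule \<Rightarrow> bool" where
  "datalog_rule ar r \<longleftrightarrow> (\<exists>p ts. head r = {Pos (Reg p ts)}) \<and>
     finite (lits r) \<and> finite (gens r) \<and> (\<forall>g\<in>gens r. lite_genlit g) \<and>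
     (\<forall>a\<in>rule_atoms r. wf_atom ar a)"

definition head_preds :: "('p, 'c) program \<Rightarrow> 'p set" where
  "head_preds P = (\<Union>r\<in>P. atoms_preds (pos (head r)))"

text \<open>The extensional predicates other than equality.\<close>

definition edb :: "('p, 'c) program \<Rightarrow> 'p set" where
  "edb P = preds P - head_preds P"

definition basic_program :: "('p \<Rightarrow> nat) \<Rightarrow> ('p, 'c) program \<Rightarrow> bool" where
  "basic_program ar P \<longleftrightarrow> finite P \<and> (\<forall>r\<in>P. datalog_rule ar r) \<and>
     (\<forall>r\<in>P. head_preds P \<inter> atoms_preds (neg (lits r)) = {} \<and>
        (\<forall>g\<in>gens r. head_preds P \<inter> atoms_preds (antecedent_atoms g) = {}))"

text \<open>
  A stratified program is given by the list \<open>Ps\<close> of its basic programs; the program itself is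
  \<open>\<Union> (set Ps)\<close>.
\<close>

definition stratified :: "('p \<Rightarrow> nat) \<Rightarrow> ('p, 'c) program list \<Rightarrow> bool" where
  "stratified ar Ps \<longleftrightarrow> (\<forall>P\<in>set Ps. basic_program ar P) \<and>
     (\<forall>p\<in>head_preds (\<Union> (set Ps)). \<exists>!i. i < length Ps \<and> p \<in> head_preds (Ps ! i)) \<and>
     (\<forall>i<length Ps. \<forall>j<length Ps. head_preds (Ps ! i) \<inter> edb (Ps ! j) \<noteq> {} \<longrightarrow> i < j)"

definition datalog_litem :: "('p \<Rightarrow> nat) \<Rightarrow> ('p, 'c) program list \<Rightarrow> bool" where
  "datalog_litem ar Ps \<longleftrightarrow> stratified ar Ps \<and> (\<forall>r\<in>\<Union> (set Ps). has_guard r)"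

definition datalog_litem_query ::
    "('p \<Rightarrow> nat) \<Rightarrow> ('p, 'c) program list \<Rightarrow> 'p \<Rightarrow> bool" where
  "datalog_litem_query ar Ps q \<longleftrightarrow> datalog_litem ar Ps \<and> q \<in> preds (\<Union> (set Ps))"

text \<open>
  An input structure with domain \<open>U\<close> is represented by its true ground regular atoms; the
  interpretation of equality as identity and of the constants as themselves is built into
  \<open>sat\<close>.
\<close>

definition input_structure ::
    "('p \<Rightarrow> nat) \<Rightarrow> ('p, 'c) program \<Rightarrow> 'c set \<Rightarrow> ('p, 'c) interp \<Rightarrow> bool" where
  "input_structure ar P U I \<longleftrightarrow> universe P U \<and> I \<subseteq> ground_atoms ar (edb P) U"

definition restrict_preds :: "('p, 'c) interp \<Rightarrow> 'p set \<Rightarrow> ('p, 'c) interp" where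
  "restrict_preds I Q = {a \<in> I. \<exists>p ts. p \<in> Q \<and> a = Reg p ts}"

text \<open>
  Models over \<open>U\<close> of the first-order clauses of a Datalog program: a generalized literal is
  read as the (possibly infinite) conjunction of its instances.
\<close>

definition clause_model ::
    "'c set \<Rightarrow> ('p, 'c) interp \<Rightarrow> ('p, 'c) program \<Rightarrow> bool" where
  "clause_model U S P \<longleftrightarrow> (\<forall>r\<in>ground U P.
     (\<forall>l\<in>lits r. sat_literal S l) \<and> (\<forall>g\<in>gens r. \<forall>b\<in>genlit_inst U S g. sat S b) \<longrightarrow>
     (\<exists>l\<in>head r. sat_literal S l))"

text \<open>
  \<open>S\<close> is the minimal model of the basic program \<open>P\<close> among those that agree with the structure
  \<open>I\<close> on the extensional predicates of \<open>P\<close>.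
\<close>

definition stratum_model ::
    "('p \<Rightarrow> nat) \<Rightarrow> 'c set \<Rightarrow> ('p, 'c) program \<Rightarrow> ('p, 'c) interp \<Rightarrow> ('p, 'c) interp \<Rightarrow> bool" where
  "stratum_model ar U P I S \<longleftrightarrow>
     minimal_in {T. T \<subseteq> ground_atoms ar (preds P) U \<and> clause_model U T P \<and>
                    restrict_preds T (edb P) = restrict_preds I (edb P)} S"

text \<open>
  \<open>lfp_model ar U Ps I W\<close>: the structures \<open>\<U>\<^sub>0 = I\<close>, \<open>\<U>\<^sub>i = \<U>\<^sub>i\<^sub>-\<^sub>1 \<union> S\<^sub>i\<close> along \<open>Ps\<close> end in \<open>W\<close>.
\<close>

fun lfp_model ::
    "('p \<Rightarrow> nat) \<Rightarrow> 'c set \<Rightarrow> ('p, 'c) program list \<Rightarrow>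
     ('p, 'c) interp \<Rightarrow> ('p, 'c) interp \<Rightarrow> bool" where
  "lfp_model ar U [] I W \<longleftrightarrow> W = I"
| "lfp_model ar U (P # Ps) I W \<longleftrightarrow> (\<exists>S. stratum_model ar U P I S \<and> lfp_model ar U Ps (I \<union> S) W)"

definition query_satisfiable ::
    "('p \<Rightarrow> nat) \<Rightarrow> ('p, 'c) program list \<Rightarrow> 'p \<Rightarrow> bool" where
  "query_satisfiable ar Ps q \<longleftrightarrow> (\<exists>U I W ts. input_structure ar (\<Union> (set Ps)) U I \<and>
     lfp_model ar U Ps I W \<and> Reg q ts \<in> W)"


section \<open>The reduction\<close>

text \<open>The variables of the free rule for \<open>p\<close> are \<open>Var 0, \<dots>, Var (ar p - 1)\<close>.\<close>

definition edb_free_rule :: "('p \<Rightarrow> nat) \<Rightarrow> 'p \<Rightarrow> ('p, 'c) rule" where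
  "edb_free_rule ar p =
     (let a = Reg p (map Var [0..<ar p]) in Rule {Pos a, Naf a} {} {})"

definition edb_free_rules :: "('p \<Rightarrow> nat) \<Rightarrow> ('p, 'c) program \<Rightarrow> ('p, 'c) program" where
  "edb_free_rules ar P = edb_free_rule ar ` edb P"

text \<open>
  The size of a program is the number of symbol occurrences: predicates, terms, naf, connectives,
  quantifiers with their variables, and one arrow per generalized literal and rule.
\<close>

fun atom_size :: "('p, 'c) atom \<Rightarrow> nat" where
  "atom_size (Reg p ts) = 1 + length ts"
| "atom_size (Eq s t) = 3"

fun literal_size :: "('p, 'c) atom literal \<Rightarrow> nat" where
  "literal_size (Pos a) = atom_size a"
| "literal_size (Naf a) = 1 + atom_size a"

fun bform_size :: "('p, 'c) atom bform \<Rightarrow> nat" where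
  "bform_size (Atm a) = atom_size a"
| "bform_size (Neg \<phi>) = 1 + bform_size \<phi>"
| "bform_size (Conj \<phi> \<psi>) = 1 + bform_size \<phi> + bform_size \<psi>"
| "bform_size (Disj \<phi> \<psi>) = 1 + bform_size \<phi> + bform_size \<psi>"

fun genlit_size :: "('p, 'c) genlit \<Rightarrow> nat" where
  "genlit_size (GenLit Y \<phi> \<psi>) = 2 + length Y + bform_size \<phi> + atom_size \<psi>"

definition rule_size :: "('p, 'c) rule \<Rightarrow> nat" where
  "rule_size r =
     1 + (\<Sum>l\<in>head r. literal_size l) + (\<Sum>l\<in>lits r. literal_size l) + (\<Sum>g\<in>gens r. genlit_size g)"

definition prog_size :: "('p, 'c) program \<Rightarrow> nat" where
  "prog_size P = (\<Sum>r\<in>P. rule_size r)"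

end

theory Submission
  imports Defs
begin

text \<open>
  A basic program \<open>P\<close> forbids its head predicates under negation and in antecedents. Hence, for
  structures agreeing on \<open>edb P\<close>, the clauses of \<open>P\<close> and the rules of its reduct express the same
  condition. The free rules turn the extensional part of an open answer set into facts of the
  reduct, so that this part is arbitrary but fixed when minimality is tested. Both the least fixed
  point models and the open answer sets are therefore the structures \<open>W\<close> whose restriction to the
  predicates of each stratum is the minimal model of that stratum relative to \<open>W\<close>.
\<close>

section \<open>Predicates\<close>

lemma atoms_preds_simps [simp]:
  "atoms_preds {} = {}"
  "atoms_preds (insert (Reg p ts) A) = insert p (atoms_preds A)"
  "atoms_preds (insert (Eq s t) A) = atoms_preds A"
  "atoms_preds (A \<union> B) = atoms_preds A \<union> atoms_preds B"
  by (auto simp: atoms_preds_def)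

lemma atoms_preds_Union: "atoms_preds (\<Union> (f ` X)) = (\<Union>x\<in>X. atoms_preds (f x))"
  by (auto simp: atoms_preds_def)

lemma atoms_preds_mono: "A \<subseteq> B \<Longrightarrow> atoms_preds A \<subseteq> atoms_preds B"
  by (auto simp: atoms_preds_def)

lemma subst_atom_eq_Reg:
  "subst_atom \<sigma> a = Reg p ts \<longleftrightarrow> (\<exists>us. a = Reg p us \<and> ts = map (subst_trm \<sigma>) us)"
  by (cases a) auto

lemma atoms_preds_subst_atom [simp]: "atoms_preds (subst_atom \<sigma> ` A) = atoms_preds A"
  unfolding atoms_preds_def image_iff by (metis subst_atom_eq_Reg)

lemma atoms_preds_insert_subst_atom [simp]:
  "atoms_preds (insert (subst_atom \<sigma> a) A) = atoms_preds (insert a A)"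
  by (cases a) auto

lemma pos_map_literal [simp]: "pos (map_literal f ` L) = f ` pos L"
proof -
  have "Pos a \<in> map_literal f ` L \<longleftrightarrow> a \<in> f ` pos L" for a
  proof -
    have "Pos a = map_literal f l \<longleftrightarrow> (\<exists>b. l = Pos b \<and> a = f b)" for l by (cases l) auto
    then show ?thesis by (auto simp: pos_def image_iff)
  qed
  then show ?thesis by (auto simp: pos_def)
qed

lemma neg_map_literal [simp]: "neg (map_literal f ` L) = f ` neg L"
proof -
  have "Naf a \<in> map_literal f ` L \<longleftrightarrow> a \<in> f ` neg L" for a
  proof -
    have "Naf a = map_literal f l \<longleftrightarrow> (\<exists>b. l = Naf b \<and> a = f b)" for l by (cases l) auto
    then show ?thesis by (auto simp: neg_def image_iff)
  qed
  then show ?thesis by (auto simp: neg_def)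
qed

lemma UN_set_literal: "\<Union> (set_literal ` L) = pos L \<union> neg L"
proof -
  have "a \<in> set_literal l \<longleftrightarrow> l = Pos a \<or> l = Naf a" for l and a :: 'a by (cases l) auto
  then show ?thesis by (auto simp: pos_def neg_def)
qed

text \<open>Separating atoms by polarity matches the definition of basic programs, which treats
  negative bodies and antecedents differently from positive bodies.\<close>

lemma rule_atoms_eq:
  "rule_atoms r = pos (head r) \<union> neg (head r) \<union> pos (lits r) \<union> neg (lits r)
     \<union> \<Union> (genlit_atoms ` gens r)"
  unfolding rule_atoms_def image_Un Union_Un_distrib UN_set_literal by auto

lemma atoms_preds_genlit_subst [simp]:
  "atoms_preds (genlit_atoms (subst_genlit \<sigma> g)) = atoms_preds (genlit_atoms g)"
  "atoms_preds (antecedent_atoms (subst_genlit \<sigma> g)) = atoms_preds (antecedent_atoms g)"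
proof -
  obtain Y \<phi> \<psi> where g: "g = GenLit Y \<phi> \<psi>" by (cases g)
  show "atoms_preds (genlit_atoms (subst_genlit \<sigma> g)) = atoms_preds (genlit_atoms g)"
    by (cases \<psi>) (simp_all add: g Let_def bform.set_map)
  show "atoms_preds (antecedent_atoms (subst_genlit \<sigma> g)) = atoms_preds (antecedent_atoms g)"
    by (simp add: g Let_def bform.set_map)
qed

lemma atoms_preds_subst_rule [simp]:
  "atoms_preds (rule_atoms (subst_rule \<sigma> r)) = atoms_preds (rule_atoms r)"
  by (simp add: rule_atoms_eq subst_rule_def atoms_preds_Union)

lemma preds_eq: "preds P = (\<Union>r\<in>P. atoms_preds (rule_atoms r))"
  by (simp add: preds_def prog_atoms_def atoms_preds_Union)

lemma head_preds_subset_preds: "head_preds P \<subseteq> preds P"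
  by (auto simp: head_preds_def preds_eq rule_atoms_eq)

lemma preds_Un [simp]: "preds (P \<union> Q) = preds P \<union> preds Q"
  by (auto simp: preds_eq)

lemma preds_Union: "preds (\<Union> X) = \<Union> (preds ` X)"
  by (auto simp: preds_eq)

lemma head_preds_Union: "head_preds (\<Union> X) = \<Union> (head_preds ` X)"
  by (auto simp: head_preds_def)

lemma preds_edb_head_preds: "preds P = edb P \<union> head_preds P"
  using head_preds_subset_preds[of P] by (auto simp: edb_def)

section \<open>Dependence of truth on predicates\<close>

lemma Reg_in_restrict_preds [simp]: "Reg p ts \<in> restrict_preds I Q \<longleftrightarrow> Reg p ts \<in> I \<and> p \<in> Q"
  by (auto simp: restrict_preds_def)

lemma restrict_preds_subset: "restrict_preds I Q \<subseteq> I"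
  by (auto simp: restrict_preds_def)

lemma restrict_preds_restrict [simp]:
  "restrict_preds (restrict_preds I Q) R = restrict_preds I (Q \<inter> R)"
  by (auto simp: restrict_preds_def)

lemma restrict_preds_eq_subset: "restrict_preds I Q = restrict_preds J Q \<Longrightarrow> R \<subseteq> Q \<Longrightarrow>
    restrict_preds I R = restrict_preds J R"
  by (metis inf.absorb_iff2 restrict_preds_restrict)

lemma restrict_preds_Un: "restrict_preds I (Q \<union> R) = restrict_preds I Q \<union> restrict_preds I R"
  by (auto simp: restrict_preds_def)

lemma restrict_preds_Un_interp:
  "restrict_preds (I \<union> J) Q = restrict_preds I Q \<union> restrict_preds J Q"
  by (auto simp: restrict_preds_def)

lemma restrict_preds_ground: "I \<subseteq> ground_atoms ar Q U \<Longrightarrow>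
    restrict_preds I R = restrict_preds I (Q \<inter> R)"
  by (fastforce simp: restrict_preds_def ground_atoms_def)

lemma restrict_preds_ident: "I \<subseteq> ground_atoms ar Q U \<Longrightarrow> Q \<subseteq> R \<Longrightarrow> restrict_preds I R = I"
  by (fastforce simp: restrict_preds_def ground_atoms_def)

lemma restrict_preds_in_ground: "I \<subseteq> ground_atoms ar Q U \<Longrightarrow>
    restrict_preds I R \<subseteq> ground_atoms ar R U"
  by (fastforce simp: restrict_preds_def ground_atoms_def)

lemma ground_atoms_mono: "Q \<subseteq> R \<Longrightarrow> ground_atoms ar Q U \<subseteq> ground_atoms ar R U"
  by (auto simp: ground_atoms_def)

text \<open>Equality atoms contribute no predicate and have the same truth value in every
  interpretation, so only regular atoms have to be compared.\<close>

lemma sat_cong: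
  assumes "restrict_preds I Q = restrict_preds J Q" "atoms_preds {a} \<subseteq> Q"
  shows "sat I a \<longleftrightarrow> sat J a"
proof (cases a)
  case (Reg p ts)
  then show ?thesis using assms(2) Reg_in_restrict_preds[of p ts I Q]
      Reg_in_restrict_preds[of p ts J Q] by (simp add: assms(1))
qed simp

lemma atoms_predsI: "a \<in> A \<Longrightarrow> atoms_preds {a} \<subseteq> atoms_preds A"
  by (rule atoms_preds_mono) simp

lemma sat_bform_cong:
  assumes "restrict_preds I Q = restrict_preds J Q" "atoms_preds (set_bform \<phi>) \<subseteq> Q"
  shows "sat_bform I \<phi> \<longleftrightarrow> sat_bform J \<phi>"
  using assms(2) by (induction \<phi>) (simp_all add: sat_cong[OF assms(1)])

text \<open>The interpretation only selects the groundings that make the antecedent true; the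
  consequent is merely instantiated. Agreement on the antecedent therefore suffices.\<close>

lemma genlit_inst_cong:
  assumes "restrict_preds I Q = restrict_preds J Q" "atoms_preds (antecedent_atoms g) \<subseteq> Q"
  shows "genlit_inst U I g = genlit_inst U J g"
proof (cases g)
  case (GenLit Y \<phi> \<psi>)
  have "sat_bform I (map_bform (subst_atom \<theta>) \<phi>) \<longleftrightarrow> sat_bform J (map_bform (subst_atom \<theta>) \<phi>)"
    for \<theta>
    using assms(2) GenLit by (intro sat_bform_cong[OF assms(1)]) (simp add: bform.set_map)
  then show ?thesis using GenLit by simp
qed

lemma genlit_inst_preds:
  "b \<in> genlit_inst U I g \<Longrightarrow> atoms_preds {b} \<subseteq> atoms_preds (genlit_atoms g)"
proof (cases g)
  case (GenLit Y \<phi> \<psi>)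
  moreover assume "b \<in> genlit_inst U I g"
  ultimately obtain \<theta> where "b = subst_atom \<theta> \<psi>" by auto
  then show ?thesis using GenLit by (simp add: atoms_predsI)
qed

lemma sat_literals: "(\<forall>l\<in>L. sat_literal I l) \<longleftrightarrow> (\<forall>a\<in>pos L. sat I a) \<and> (\<forall>a\<in>neg L. \<not> sat I a)"
proof -
  have "(\<forall>l\<in>L. sat_literal I l) \<longleftrightarrow>
      (\<forall>a. Pos a \<in> L \<longrightarrow> sat I a) \<and> (\<forall>a. Naf a \<in> L \<longrightarrow> \<not> sat I a)"
    by (metis literal.exhaust sat_literal.simps)
  then show ?thesis by (simp add: pos_def neg_def)
qed

section \<open>Reducts\<close>

text \<open>Both reducts are taken with the same \<open>W\<close>. The result stays fixed while
  minimality is tested, so that only the candidate model \<open>J\<close> varies.\<close>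

definition geli_gl_reduct ::
    "'c set \<Rightarrow> ('p, 'c) program \<Rightarrow> ('p, 'c) interp \<Rightarrow> (('p, 'c) atom set \<times> ('p, 'c) atom set) set" where
  "geli_gl_reduct U P W = reduct (geli_reduct U W (ground U P)) W"

lemma ground_Union: "ground U (\<Union> X) = \<Union> (ground U ` X)"
  by (auto simp: ground_def)

lemma ground_Un: "ground U (P \<union> Q) = ground U P \<union> ground U Q"
  by (auto simp: ground_def)

text \<open>Separates what is frozen from what varies: negative literals and antecedents are read in
  \<open>W\<close>, whereas positive bodies, instances of consequents and positive heads are read in
  \<open>J\<close>. In this form the reduct can be compared with \<open>clause_model\<close> rule by
  rule.\<close>

lemma reduct_model_geli_gl_reduct:
  "reduct_model J (geli_gl_reduct U P W) \<longleftrightarrow>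
     (\<forall>r\<in>ground U P. (\<forall>a\<in>neg (lits r). \<not> sat W a) \<and> (\<forall>a\<in>neg (head r). sat W a) \<and>
        (\<forall>a\<in>pos (lits r). sat J a) \<and> (\<forall>g\<in>gens r. \<forall>b\<in>genlit_inst U W g. sat J b) \<longrightarrow>
        (\<exists>a\<in>pos (head r). sat J a))"
proof -
  have lits: "neg (L \<union> Pos ` A) = neg L" "pos (L \<union> Pos ` A) = pos L \<union> A"
    for L and A :: "('a, 'b) atom set"
    by (auto simp: neg_def pos_def)
  have reduct: "reduct_model J (reduct Q W) \<longleftrightarrow>
      (\<forall>r\<in>Q. (\<forall>a\<in>neg (lits r). \<not> sat W a) \<and> (\<forall>a\<in>neg (head r). sat W a) \<and>
        (\<forall>a\<in>pos (lits r). sat J a) \<longrightarrow> (\<exists>a\<in>pos (head r). sat J a))" for Q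
    unfolding reduct_model_def reduct_def by auto
  show ?thesis
    by (simp add: geli_gl_reduct_def reduct geli_reduct_def lits ball_Un)
qed

lemma reduct_model_Un: "reduct_model J (geli_gl_reduct U (P \<union> Q) W) \<longleftrightarrow>
    reduct_model J (geli_gl_reduct U P W) \<and> reduct_model J (geli_gl_reduct U Q W)"
  unfolding reduct_model_geli_gl_reduct ground_Un by blast

lemma reduct_model_Union: "reduct_model J (geli_gl_reduct U (\<Union> X) W) \<longleftrightarrow>
    (\<forall>P\<in>X. reduct_model J (geli_gl_reduct U P W))"
  unfolding reduct_model_geli_gl_reduct ground_Union by blast

lemma ground_datalog_head:
  assumes "\<forall>r\<in>P. datalog_rule ar r" "r \<in> ground U P"
  obtains p ts where "p \<in> head_preds P" "head r = {Pos (Reg p ts)}"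
proof -
  obtain r' \<sigma> where r': "r' \<in> P" "r = subst_rule \<sigma> r'"
    using assms(2) by (auto simp: ground_def)
  obtain p ts where "head r' = {Pos (Reg p ts)}"
    using assms(1) r'(1) by (auto simp: datalog_rule_def)
  moreover from this have "p \<in> head_preds P"
    using r'(1) unfolding head_preds_def by (intro UN_I) (auto simp: pos_def atoms_preds_def)
  ultimately show ?thesis using that r'(2) by (simp add: subst_rule_def)
qed

text \<open>Grounding changes terms only, so predicates can be inspected in the original rule. Those
  under negation or in antecedents are predicates of \<open>P\<close> but not head predicates, hence
  extensional.\<close>

lemma ground_basic_program:
  assumes "basic_program ar P" "r \<in> ground U P"
  shows "atoms_preds (pos (lits r)) \<subseteq> preds P"
    and "atoms_preds (neg (lits r)) \<subseteq> edb P"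
    and "g \<in> gens r \<Longrightarrow> atoms_preds (antecedent_atoms g) \<subseteq> edb P"
    and "g \<in> gens r \<Longrightarrow> atoms_preds (genlit_atoms g) \<subseteq> preds P"
proof -
  obtain r' \<sigma> where r': "r' \<in> P" "r = subst_rule \<sigma> r'"
    using assms(2) by (auto simp: ground_def)
  have sub: "atoms_preds (rule_atoms r') \<subseteq> preds P"
    using r'(1) by (auto simp: preds_eq)
  have basic: "head_preds P \<inter> atoms_preds (neg (lits r')) = {}"
    "\<forall>g\<in>gens r'. head_preds P \<inter> atoms_preds (antecedent_atoms g) = {}"
    using assms(1) r'(1) by (auto simp: basic_program_def)
  show "atoms_preds (pos (lits r)) \<subseteq> preds P"
    using r'(2) sub by (simp add: subst_rule_def rule_atoms_eq)
  show "atoms_preds (neg (lits r)) \<subseteq> edb P"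
    using r'(2) sub basic(1) by (auto simp: subst_rule_def rule_atoms_eq edb_def)
  assume "g \<in> gens r"
  then obtain g' where g': "g' \<in> gens r'" "g = subst_genlit \<sigma> g'"
    using r'(2) by (auto simp: subst_rule_def)
  have genlit: "atoms_preds (genlit_atoms g') \<subseteq> preds P"
    using sub g'(1) by (auto simp: rule_atoms_eq atoms_preds_Union)
  then show "atoms_preds (genlit_atoms g) \<subseteq> preds P" using g'(2) by simp
  have "antecedent_atoms g' \<subseteq> genlit_atoms g'" by (cases g') auto
  then show "atoms_preds (antecedent_atoms g) \<subseteq> edb P"
    using genlit basic(2) g' atoms_preds_mono[of "antecedent_atoms g'" "genlit_atoms g'"]
    by (fastforce simp: edb_def)
qed

lemma reduct_model_iff_clause_model:
  assumes P: "basic_program ar P"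
    and agree: "restrict_preds J (edb P) = restrict_preds W (edb P)"
  shows "reduct_model J (geli_gl_reduct U P W) \<longleftrightarrow> clause_model U (restrict_preds J (preds P)) P"
proof -
  let ?T = "restrict_preds J (preds P)"
  have T: "restrict_preds ?T (preds P) = restrict_preds J (preds P)" by simp
  have edb: "edb P \<subseteq> preds P" by (auto simp: edb_def)
  have TW: "restrict_preds ?T (edb P) = restrict_preds W (edb P)"
    using edb agree by (simp add: Int_absorb1)
  have "((\<forall>a\<in>neg (lits r). \<not> sat W a) \<and> (\<forall>a\<in>neg (head r). sat W a) \<and>
        (\<forall>a\<in>pos (lits r). sat J a) \<and> (\<forall>g\<in>gens r. \<forall>b\<in>genlit_inst U W g. sat J b) \<longrightarrow>
        (\<exists>a\<in>pos (head r). sat J a)) \<longleftrightarrow>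
      ((\<forall>l\<in>lits r. sat_literal ?T l) \<and> (\<forall>g\<in>gens r. \<forall>b\<in>genlit_inst U ?T g. sat ?T b) \<longrightarrow>
        (\<exists>l\<in>head r. sat_literal ?T l))" if r: "r \<in> ground U P" for r
  proof -
    note ground = ground_basic_program[OF P r]
    obtain p ts where p: "p \<in> head_preds P" "head r = {Pos (Reg p ts)}"
      using ground_datalog_head[of P ar r U] r P by (auto simp: basic_program_def)
    have "(\<exists>a\<in>pos (head r). sat J a) \<longleftrightarrow> (\<exists>l\<in>head r. sat_literal ?T l)"
      using p head_preds_subset_preds[of P] by (auto simp: pos_def)
    moreover have "neg (head r) = {}" using p by (simp add: neg_def)
    moreover have "sat W a \<longleftrightarrow> sat ?T a" if "a \<in> neg (lits r)" for a
      using ground(2) atoms_predsI[OF that] by (intro sat_cong[OF TW[symmetric]]) auto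
    moreover have "sat J a \<longleftrightarrow> sat ?T a" if "a \<in> pos (lits r)" for a
      using ground(1) atoms_predsI[OF that] by (intro sat_cong[OF T[symmetric]]) auto
    moreover have "genlit_inst U W g = genlit_inst U ?T g" if "g \<in> gens r" for g
      using ground(3)[OF that] by (rule genlit_inst_cong[OF TW[symmetric]])
    moreover have "sat J b \<longleftrightarrow> sat ?T b" if "g \<in> gens r" "b \<in> genlit_inst U ?T g" for g b
      using genlit_inst_preds[OF that(2)] ground(4)[OF that(1)]
      by (intro sat_cong[OF T[symmetric]]) auto
    ultimately show ?thesis unfolding sat_literals by auto
  qed
  then show ?thesis unfolding reduct_model_geli_gl_reduct clause_model_def by (rule ball_cong[OF refl])
qed

section \<open>The free rules\<close>

lemma edb_free_rule_simps [simp]: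
  "head (edb_free_rule ar p) =
     {Pos (Reg p (map Var [0..<ar p])), Naf (Reg p (map Var [0..<ar p]))}"
  "lits (edb_free_rule ar p) = {}"
  "gens (edb_free_rule ar p) = {}"
  by (simp_all add: edb_free_rule_def Let_def)

lemma rule_fv_edb_free_rule: "rule_fv (edb_free_rule ar p) = {..<ar p}"
  by (auto simp: rule_fv_def atom_vars_def)

lemma rule_atoms_edb_free_rule:
  "rule_atoms (edb_free_rule ar p) = {Reg p (map Var [0..<ar p])}"
  by (auto simp: rule_atoms_def)

lemma preds_edb_free_rules: "preds (edb_free_rules ar P) = edb P"
  by (auto simp: preds_eq edb_free_rules_def rule_atoms_edb_free_rule)

lemma preds_Un_edb_free_rules: "preds (P \<union> edb_free_rules ar P) = preds P"
  by (auto simp: preds_edb_free_rules edb_def)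

text \<open>Free rules contain only variables, so they add no constants.\<close>

lemma universe_Un_edb_free_rules: "universe (P \<union> edb_free_rules ar P) U \<longleftrightarrow> universe P U"
proof -
  have "prog_consts (P \<union> edb_free_rules ar P) = prog_consts P"
    by (auto simp: prog_consts_def prog_atoms_def edb_free_rules_def rule_atoms_edb_free_rule)
  then show ?thesis by (simp add: universe_def)
qed

lemma edb_free_rule_instance:
  assumes "length cs = ar p" "set cs \<subseteq> U"
  obtains \<sigma> where "\<sigma> \<in> groundings U {..<ar p}"
    "subst_atom \<sigma> (Reg p (map Var [0..<ar p])) = Reg p (map Const cs)"
proof
  \<comment> \<open>The value \<open>None\<close> beyond the arity matters, since
    \<open>groundings\<close> requires the domain to be exactly the set of free variables.\<close>
  let ?\<sigma> = "\<lambda>i. if i < ar p then Some (cs ! i) else None"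
  show "?\<sigma> \<in> groundings U {..<ar p}"
    using assms by (auto simp: groundings_def ran_def split: if_splits)
  show "subst_atom ?\<sigma> (Reg p (map Var [0..<ar p])) = Reg p (map Const cs)"
    using assms by (auto intro!: nth_equalityI)
qed

text \<open>A ground instance of a free rule for an atom \<open>a\<close> disappears from the reduct
  if \<open>a\<close> is false in \<open>W\<close>, and becomes the fact \<open>a\<close> otherwise.
  The arguments of the free rule are distinct variables, so every extensional ground atom of
  \<open>W\<close> is such an instance.\<close>

lemma reduct_model_edb_free_rules:
  assumes W: "W \<subseteq> ground_atoms ar Q U"
  shows "reduct_model J (geli_gl_reduct U (edb_free_rules ar P) W) \<longleftrightarrow> restrict_preds W (edb P) \<subseteq> J"
proof -
  let ?a = "\<lambda>p. Reg p (map Var [0..<ar p]) :: ('a, 'b) atom"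
  have "reduct_model J (geli_gl_reduct U (edb_free_rules ar P) W) \<longleftrightarrow>
      (\<forall>p\<in>edb P. \<forall>\<sigma>\<in>groundings U {..<ar p}.
        sat W (subst_atom \<sigma> (?a p)) \<longrightarrow> sat J (subst_atom \<sigma> (?a p)))"
    by (auto simp: reduct_model_geli_gl_reduct ground_def edb_free_rules_def rule_fv_edb_free_rule
        subst_rule_def pos_def neg_def)
  also have "\<dots> \<longleftrightarrow> restrict_preds W (edb P) \<subseteq> J"
  proof
    assume *: "\<forall>p\<in>edb P. \<forall>\<sigma>\<in>groundings U {..<ar p}.
        sat W (subst_atom \<sigma> (?a p)) \<longrightarrow> sat J (subst_atom \<sigma> (?a p))"
    show "restrict_preds W (edb P) \<subseteq> J"
    proof
      fix a assume a: "a \<in> restrict_preds W (edb P)"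
      then have "a \<in> ground_atoms ar Q U" using W restrict_preds_subset by blast
      then obtain p cs where cs: "a = Reg p (map Const cs)" "length cs = ar p" "set cs \<subseteq> U"
        by (auto simp: ground_atoms_def)
      obtain \<sigma> where \<sigma>: "\<sigma> \<in> groundings U {..<ar p}" "subst_atom \<sigma> (?a p) = Reg p (map Const cs)"
        by (rule edb_free_rule_instance[of cs ar p U]) (use cs in auto)
      have "p \<in> edb P" "sat W a" using a cs(1) by auto
      then have "sat J (subst_atom \<sigma> (?a p))" using * \<sigma> cs(1) by metis
      then show "a \<in> J" using \<sigma>(2) cs(1) by simp
    qed
  next
    assume "restrict_preds W (edb P) \<subseteq> J"
    then show "\<forall>p\<in>edb P. \<forall>\<sigma>\<in>groundings U {..<ar p}.
        sat W (subst_atom \<sigma> (?a p)) \<longrightarrow> sat J (subst_atom \<sigma> (?a p))"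
      by auto
  qed
  finally show ?thesis .
qed

section \<open>Stratification\<close>

text \<open>
  \<open>layered D Ps\<close>: each program of \<open>Ps\<close> builds on the predicates in \<open>D\<close> and those defined by its
  predecessors, and defines only new ones. This is the shape of stratification suited to induction
  along \<open>Ps\<close>.
\<close>

fun layered :: "'p set \<Rightarrow> ('p, 'c) program list \<Rightarrow> bool" where
  "layered D [] \<longleftrightarrow> True"
| "layered D (P # Ps) \<longleftrightarrow> edb P \<subseteq> D \<and> head_preds P \<inter> D = {} \<and> layered (D \<union> head_preds P) Ps"

lemma layered_iff:
  "layered D Ps \<longleftrightarrow> (\<forall>i<length Ps. edb (Ps ! i) \<subseteq> D \<union> (\<Union>j<i. head_preds (Ps ! j)) \<and>
     head_preds (Ps ! i) \<inter> (D \<union> (\<Union>j<i. head_preds (Ps ! j))) = {})"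
proof (induction Ps arbitrary: D)
  case (Cons P Ps)
  \<comment> \<open>Dropping the first program shifts indices by one and moves its head predicates
    from the union into the base set.\<close>
  have Un: "D \<union> (\<Union>j<Suc i. head_preds ((P # Ps) ! j)) =
      D \<union> head_preds P \<union> (\<Union>j<i. head_preds (Ps ! j))" for i
    unfolding lessThan_Suc_eq_insert_0 by auto
  show ?case
    unfolding layered.simps Cons.IH list.size add_Suc_right add_0_right All_less_Suc2 Un by auto
qed simp

lemma stratified_head_unique:
  assumes "stratified ar Ps" "i < length Ps" "j < length Ps"
    "p \<in> head_preds (Ps ! i)" "p \<in> head_preds (Ps ! j)"
  shows "i = j"
proof -
  have "p \<in> head_preds (\<Union> (set Ps))" using assms(2,4) by (auto simp: head_preds_Union)
  then have "\<exists>!i. i < length Ps \<and> p \<in> head_preds (Ps ! i)"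
    using assms(1) by (auto simp: stratified_def)
  then show ?thesis using assms by blast
qed

text \<open>A predicate extensional in one stratum is either extensional in the whole program or a
  head predicate of some stratum; in the latter case the order condition puts that stratum earlier.
  Head predicates are new because each has a single defining stratum.\<close>

lemma stratified_layered:
  assumes "stratified ar Ps"
  shows "layered (edb (\<Union> (set Ps))) Ps"
  unfolding layered_iff
proof (intro allI impI conjI)
  fix i assume i: "i < length Ps"
  show "edb (Ps ! i) \<subseteq> edb (\<Union> (set Ps)) \<union> (\<Union>j<i. head_preds (Ps ! j))"
  proof
    fix p assume p: "p \<in> edb (Ps ! i)"
    then have pP: "p \<in> preds (\<Union> (set Ps))" using i by (auto simp: preds_Union edb_def)
    show "p \<in> edb (\<Union> (set Ps)) \<union> (\<Union>j<i. head_preds (Ps ! j))"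
    proof (cases "p \<in> head_preds (\<Union> (set Ps))")
      case True
      then obtain j where "j < length Ps" "p \<in> head_preds (Ps ! j)"
        by (auto simp: head_preds_Union in_set_conv_nth)
      moreover from this have "j < i" using assms i p unfolding stratified_def by blast
      ultimately show ?thesis by auto
    qed (use pP in \<open>auto simp: edb_def\<close>)
  qed
  have "head_preds (Ps ! i) \<inter> edb (\<Union> (set Ps)) = {}"
    using i by (auto simp: edb_def head_preds_Union)
  moreover have "head_preds (Ps ! i) \<inter> head_preds (Ps ! j) = {}" if "j < i" for j
    using stratified_head_unique[OF assms i, of j] that i by fastforce
  ultimately show "head_preds (Ps ! i) \<inter> (edb (\<Union> (set Ps)) \<union> (\<Union>j<i. head_preds (Ps ! j))) = {}"
    by blast
qed

text \<open>Allows an intermediate structure to be replaced with the final one, which agrees with it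
  on the predicates that the stratum builds on.\<close>

lemma stratum_model_cong:
  "restrict_preds I (edb P) = restrict_preds J (edb P) \<Longrightarrow>
    stratum_model ar U P I S \<longleftrightarrow> stratum_model ar U P J S"
  by (simp add: stratum_model_def)

lemma stratum_modelD:
  assumes "stratum_model ar U P I S"
  shows "S \<subseteq> ground_atoms ar (preds P) U" "restrict_preds S (edb P) = restrict_preds I (edb P)"
  using assms by (auto simp: stratum_model_def minimal_in_def)

text \<open>Later strata define only new predicates and so never alter what has been built. The
  input and all the \<open>S\<close> chosen on the way are therefore restrictions of the final
  \<open>W\<close>, which removes the existential quantifiers from the iteration.\<close>

lemma lfp_model_iff:
  assumes "layered D Ps" "I \<subseteq> ground_atoms ar D U"
  shows "lfp_model ar U Ps I W \<longleftrightarrow>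
    W \<subseteq> ground_atoms ar (D \<union> head_preds (\<Union> (set Ps))) U \<and> restrict_preds W D = I \<and>
    (\<forall>P\<in>set Ps. stratum_model ar U P W (restrict_preds W (preds P)))"
  using assms
proof (induction Ps arbitrary: D I)
  case Nil
  then show ?case using restrict_preds_ident[of _ ar D U D] by (auto simp: head_preds_def)
next
  case (Cons P Ps)
  let ?D = "D \<union> head_preds P"
  have lay: "edb P \<subseteq> D" "head_preds P \<inter> D = {}" "layered ?D Ps" using Cons.prems(1) by auto
  have pD: "preds P \<subseteq> ?D" using lay(1) by (auto simp: preds_edb_head_preds)
  have heads: "?D \<union> head_preds (\<Union> (set Ps)) = D \<union> head_preds (\<Union> (set (P # Ps)))"
    by (auto simp: head_preds_def)
  let ?G = "W \<subseteq> ground_atoms ar (D \<union> head_preds (\<Union> (set (P # Ps)))) U"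
  have IH: "lfp_model ar U Ps (I \<union> S) W \<longleftrightarrow> ?G \<and> restrict_preds W ?D = I \<union> S \<and>
      (\<forall>P\<in>set Ps. stratum_model ar U P W (restrict_preds W (preds P)))"
    if "stratum_model ar U P I S" for S
  proof -
    have "I \<union> S \<subseteq> ground_atoms ar ?D U"
      using stratum_modelD(1)[OF that] Cons.prems(2) ground_atoms_mono[OF pD]
        ground_atoms_mono[of D ?D] by blast
    from Cons.IH[OF lay(3) this] show ?thesis unfolding heads .
  qed
  \<comment> \<open>This determines \<open>S\<close> from \<open>W\<close>, so the existential
    quantifier over \<open>S\<close> can be eliminated at the end.\<close>
  have step: "stratum_model ar U P I S \<and> restrict_preds W ?D = I \<union> S \<longleftrightarrow>
      restrict_preds W D = I \<and> S = restrict_preds W (preds P) \<and> stratum_model ar U P W S" for S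
  proof (intro iffI conjI; elim conjE)
    assume S: "stratum_model ar U P I S" and W: "restrict_preds W ?D = I \<union> S"
    note SD = stratum_modelD[OF S]
    have "restrict_preds W D = restrict_preds (restrict_preds W ?D) D"
      by (simp add: Int_absorb1)
    also have "\<dots> = restrict_preds I D \<union> restrict_preds S D"
      unfolding W restrict_preds_Un_interp ..
    \<comment> \<open>\<open>S\<close> contains only predicates of \<open>P\<close>, and those that
      lie in \<open>D\<close> are exactly the extensional ones because the head predicates are
      new.\<close>
    also have "restrict_preds S D = restrict_preds S (edb P)"
      using restrict_preds_ground[OF SD(1), of D] lay
      by (metis Int_Un_distrib2 Int_absorb2 preds_edb_head_preds sup_bot_right)
    also have "restrict_preds I D = I" by (rule restrict_preds_ident[OF Cons.prems(2)]) simp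
    finally show WD: "restrict_preds W D = I"
      using SD(2) restrict_preds_subset[of I] by blast
    have agree: "restrict_preds I (edb P) = restrict_preds W (edb P)"
      unfolding WD[symmetric] using lay(1) by (simp add: Int_absorb1)
    show "stratum_model ar U P W S" using S stratum_model_cong[OF agree] by blast
    have "restrict_preds W (preds P) = restrict_preds (restrict_preds W ?D) (preds P)"
      using pD by (simp add: Int_absorb1)
    also have "\<dots> = restrict_preds I (preds P) \<union> S"
      unfolding W restrict_preds_Un_interp by (simp add: restrict_preds_ident[OF SD(1)])
    also have "restrict_preds I (preds P) = restrict_preds I (edb P)"
      using restrict_preds_ground[OF Cons.prems(2), of "preds P"] lay
      by (metis Int_Un_distrib Int_absorb1 Int_commute preds_edb_head_preds sup_bot_right)
    finally show "S = restrict_preds W (preds P)"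
      using SD(2) restrict_preds_subset[of S] by blast
  next
    assume W: "restrict_preds W D = I" "S = restrict_preds W (preds P)"
      "stratum_model ar U P W S"
    have agree: "restrict_preds (restrict_preds W D) (edb P) = restrict_preds W (edb P)"
      using lay(1) by (simp add: Int_absorb1)
    show "stratum_model ar U P I S"
      using W stratum_model_cong[OF agree] by blast
    have "?D = D \<union> preds P" using lay(1) by (auto simp: preds_edb_head_preds)
    then show "restrict_preds W ?D = I \<union> S"
      using W(1,2) by (simp add: restrict_preds_Un)
  qed
  have "lfp_model ar U (P # Ps) I W \<longleftrightarrow>
      (\<exists>S. (stratum_model ar U P I S \<and> restrict_preds W ?D = I \<union> S) \<and> ?G \<and>
        (\<forall>P\<in>set Ps. stratum_model ar U P W (restrict_preds W (preds P))))"
    unfolding lfp_model.simps using IH by blast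
  then show ?case unfolding step by auto
qed

section \<open>Answer sets and strata\<close>

text \<open>Induction along the strata. Agreement on \<open>D\<close> covers the extensional
  predicates of the next stratum \<open>P\<close>, so the restriction of \<open>N\<close> to
  \<open>preds P\<close> competes with that of \<open>W\<close> for minimality and must equal it.
  The head predicates of \<open>P\<close> then join \<open>D\<close>.\<close>

lemma reduct_model_strata_unique:
  assumes "layered D Ps" "\<forall>P\<in>set Ps. basic_program ar P"
    and strata: "\<forall>P\<in>set Ps. stratum_model ar U P W (restrict_preds W (preds P))"
    and N: "N \<subseteq> W" "\<forall>P\<in>set Ps. reduct_model N (geli_gl_reduct U P W)"
    and "restrict_preds N D = restrict_preds W D"
  shows "restrict_preds N (D \<union> head_preds (\<Union> (set Ps))) =
    restrict_preds W (D \<union> head_preds (\<Union> (set Ps)))"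
  using assms
proof (induction Ps arbitrary: D)
  case Nil
  then show ?case by (simp add: head_preds_def)
next
  case (Cons P Ps)
  let ?T = "restrict_preds N (preds P)" and ?S = "restrict_preds W (preds P)"
  have lay: "edb P \<subseteq> D" "layered (D \<union> head_preds P) Ps" using Cons.prems(1) by auto
  have agree: "restrict_preds N (edb P) = restrict_preds W (edb P)"
    using Cons.prems(6) lay(1) by (rule restrict_preds_eq_subset)
  have S: "stratum_model ar U P W ?S" using Cons.prems(3) by simp
  have TS: "?T \<subseteq> ?S" using Cons.prems(4) by (auto simp: restrict_preds_def)
  have "clause_model U ?T P"
    using reduct_model_iff_clause_model[of ar P N W U] agree Cons.prems(2,5) by simp
  moreover have "restrict_preds ?T (edb P) = restrict_preds W (edb P)"
    using agree by (simp add: preds_edb_head_preds Int_Un_distrib2 Int_absorb1)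
  moreover have "?T \<subseteq> ground_atoms ar (preds P) U"
    using TS stratum_modelD(1)[OF S] by blast
  ultimately have "?T = ?S" using S TS by (simp add: stratum_model_def minimal_in_def)
  then have "restrict_preds N (head_preds P) = restrict_preds W (head_preds P)"
    using head_preds_subset_preds by (rule restrict_preds_eq_subset)
  then have "restrict_preds N (D \<union> head_preds P) = restrict_preds W (D \<union> head_preds P)"
    using Cons.prems(6) by (simp add: restrict_preds_Un)
  moreover have "D \<union> head_preds (\<Union> (set (P # Ps))) = D \<union> head_preds P \<union> head_preds (\<Union> (set Ps))"
    by (auto simp: head_preds_def)
  ultimately show ?case using Cons.IH[OF lay(2)] Cons.prems by simp
qed

text \<open>
  Replacing the part of \<open>W\<close> defined by the stratum \<open>P\<close> by a smaller model \<open>T\<close> of \<open>P\<close> preserves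
  the reduct: the rules of the other strata have heads outside \<open>head_preds P\<close>, and their positive
  bodies only become harder to satisfy.
\<close>

lemma reduct_model_replace_stratum:
  assumes basic: "\<forall>P\<in>X. basic_program ar P" and P: "P \<in> X"
    and disj: "\<forall>Q\<in>X. Q \<noteq> P \<longrightarrow> head_preds Q \<inter> head_preds P = {}"
    and W: "\<forall>Q\<in>X. reduct_model W (geli_gl_reduct U Q W)"
      "W \<subseteq> ground_atoms ar R U"
    and T: "T \<subseteq> restrict_preds W (preds P)" "clause_model U T P"
      "restrict_preds T (edb P) = restrict_preds W (edb P)"
    and Q: "Q \<in> X"
  shows "reduct_model (T \<union> restrict_preds W (- head_preds P)) (geli_gl_reduct U Q W)"
proof -
  let ?N = "T \<union> restrict_preds W (- head_preds P)"
  have NW: "?N \<subseteq> W" using T(1) by (auto simp: restrict_preds_def)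
  have TP: "restrict_preds T (preds P) = T" using T(1) by (auto simp: restrict_preds_def)
  have edb: "preds P \<inter> edb P = edb P" "- head_preds P \<inter> edb P = edb P"
    "- head_preds P \<inter> preds P = edb P"
    by (auto simp: edb_def)
  \<comment> \<open>The second piece of \<open>?N\<close> meets \<open>preds P\<close> only in
    extensional predicates, where it agrees with \<open>T\<close>.\<close>
  have NP: "restrict_preds ?N (preds P) = T"
    unfolding restrict_preds_Un_interp TP restrict_preds_restrict edb T(3)[symmetric]
    using restrict_preds_subset[of T "edb P"] by blast
  have Nedb: "restrict_preds ?N (edb P) = restrict_preds W (edb P)"
    unfolding restrict_preds_Un_interp restrict_preds_restrict edb T(3) by blast
  show ?thesis
  proof (cases "Q = P")
    case True
    then show ?thesis
      using reduct_model_iff_clause_model[of ar P ?N W U] Nedb basic P T(2) NP by simp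
  next
    case False
    have "\<exists>a\<in>pos (head r). sat ?N a"
      if r: "r \<in> ground U Q" and body: "\<forall>a\<in>neg (lits r). \<not> sat W a" "\<forall>a\<in>neg (head r). sat W a"
        "\<forall>a\<in>pos (lits r). sat ?N a" "\<forall>g\<in>gens r. \<forall>b\<in>genlit_inst U W g. sat ?N b" for r
    proof -
      have mono: "sat ?N a \<Longrightarrow> sat W a" for a using NW by (cases a) auto
      obtain p ts where p: "p \<in> head_preds Q" "head r = {Pos (Reg p ts)}"
        using ground_datalog_head[of Q ar r U] r basic Q by (auto simp: basic_program_def)
      have "\<exists>a\<in>pos (head r). sat W a"
        using W(1) Q r body mono unfolding reduct_model_geli_gl_reduct by blast
      then have "Reg p ts \<in> W" using p(2) by (auto simp: pos_def)
      moreover have "p \<notin> head_preds P" using p(1) disj Q False by blast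
      ultimately show ?thesis using p(2) by (auto simp: pos_def)
    qed
    then show ?thesis unfolding reduct_model_geli_gl_reduct by blast
  qed
qed

text \<open>From left to right, a smaller model of one stratum would give a smaller model of the
  whole reduct. From right to left, minimality of the strata propagates upwards from the extensional
  part, which the free rules fix.\<close>

lemma answer_set_iff_strata:
  assumes strat: "stratified ar Ps"
    and W: "W \<subseteq> ground_atoms ar (preds (\<Union> (set Ps))) U"
  shows "answer_set (geli_reduct U W (ground U (\<Union> (set Ps) \<union> edb_free_rules ar (\<Union> (set Ps))))) W
    \<longleftrightarrow> (\<forall>P\<in>set Ps. stratum_model ar U P W (restrict_preds W (preds P)))"
proof -
  let ?P = "\<Union> (set Ps)"
  define red where "red J \<longleftrightarrow> (\<forall>P\<in>set Ps. reduct_model J (geli_gl_reduct U P W)) \<and>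
      restrict_preds W (edb ?P) \<subseteq> J" for J
  have as: "answer_set (geli_reduct U W (ground U (?P \<union> edb_free_rules ar ?P))) W \<longleftrightarrow>
      red W \<and> (\<forall>N\<subseteq>W. red N \<longrightarrow> N = W)"
    unfolding answer_set_def minimal_in_def geli_gl_reduct_def[symmetric] red_def
      reduct_model_Un reduct_model_Union reduct_model_edb_free_rules[OF W] by blast
  have basic: "\<forall>P\<in>set Ps. basic_program ar P" using strat by (simp add: stratified_def)
  have clause_W: "reduct_model W (geli_gl_reduct U P W) \<longleftrightarrow>
      clause_model U (restrict_preds W (preds P)) P" if "P \<in> set Ps" for P
    using reduct_model_iff_clause_model[of ar P W W U] basic that by blast
  show ?thesis unfolding as
  proof safe
    fix P assume P: "P \<in> set Ps" and redW: "red W" and min: "\<forall>N\<subseteq>W. red N \<longrightarrow> N = W"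
    let ?S = "restrict_preds W (preds P)"
    \<comment> \<open>A competitor \<open>T\<close> for the stratum is completed by the part of
      \<open>W\<close> that \<open>P\<close> does not define. The result \<open>?N\<close> competes
      with \<open>W\<close>, hence equals it.\<close>
    have "T = ?S" if T: "clause_model U T P" "restrict_preds T (edb P) = restrict_preds W (edb P)"
      "T \<subseteq> ?S" for T
    proof -
      let ?N = "T \<union> restrict_preds W (- head_preds P)"
      have disj: "\<forall>Q\<in>set Ps. Q \<noteq> P \<longrightarrow> head_preds Q \<inter> head_preds P = {}"
        using stratified_head_unique[OF strat] P by (fastforce simp: in_set_conv_nth)
      have "\<forall>Q\<in>set Ps. reduct_model ?N (geli_gl_reduct U Q W)"
        using reduct_model_replace_stratum[OF basic P disj _ W T(3,1,2)] redW
        by (simp add: red_def)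
      \<comment> \<open>The facts given by the free rules survive, since only head predicates of
        \<open>P\<close> are changed.\<close>
      moreover have "edb ?P \<subseteq> - head_preds P" using P by (auto simp: edb_def head_preds_Union)
      then have "restrict_preds W (edb ?P) \<subseteq> ?N" by (auto simp: restrict_preds_def)
      moreover have "?N \<subseteq> W" using T(3) by (auto simp: restrict_preds_def)
      ultimately have NW: "?N = W" using min by (simp add: red_def)
      have edb: "restrict_preds W (edb P) \<subseteq> T" using T(2) restrict_preds_subset by metis
      have "?S \<subseteq> T"
      proof
        fix a assume "a \<in> ?S"
        then obtain p ts where a: "a = Reg p ts" "p \<in> preds P" "a \<in> W"
          by (auto simp: restrict_preds_def)
        \<comment> \<open>An atom outside \<open>T\<close> comes from the other piece of
          \<open>?N\<close>, so its predicate is not a head predicate of \<open>P\<close>.\<close>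
        then have "a \<in> T \<or> p \<in> edb P" using NW by (auto simp: edb_def)
        then show "a \<in> T" using a edb by auto
      qed
      then show ?thesis using T(3) by blast
    qed
    moreover have "clause_model U ?S P" using clause_W P redW by (simp add: red_def)
    moreover have "?S \<subseteq> ground_atoms ar (preds P) U" using W by (rule restrict_preds_in_ground)
    ultimately show "stratum_model ar U P W ?S"
      by (simp add: stratum_model_def minimal_in_def preds_edb_head_preds Int_Un_distrib2 Int_absorb1)
  next
    assume strata: "\<forall>P\<in>set Ps. stratum_model ar U P W (restrict_preds W (preds P))"
    then show "red W"
      using clause_W restrict_preds_subset[of W]
      by (auto simp: red_def stratum_model_def minimal_in_def)
    fix N a assume N: "N \<subseteq> W" "red N" and a: "a \<in> W"
    \<comment> \<open>The facts from the free rules make \<open>N\<close> agree with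
      \<open>W\<close> on the extensional predicates, which is the start of the induction along the
      strata.\<close>
    have "restrict_preds W (edb ?P) \<subseteq> restrict_preds N (edb ?P)"
      using N by (auto simp: red_def restrict_preds_def)
    then have "restrict_preds N (edb ?P) = restrict_preds W (edb ?P)"
      using N by (auto simp: restrict_preds_def)
    from reduct_model_strata_unique[OF stratified_layered[OF strat] basic strata N(1) _ this] N(2)
    have "restrict_preds N (preds ?P) = restrict_preds W (preds ?P)"
      by (simp add: red_def preds_edb_head_preds)
    moreover have "restrict_preds W (preds ?P) = W" using restrict_preds_ident[OF W] by simp
    ultimately show "a \<in> N" using restrict_preds_subset[of N] a by blast
  qed
qed

text \<open>Both sides amount to the same condition on \<open>W\<close>. The witness for
  \<open>I\<close> is the extensional part of \<open>W\<close>.\<close>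

lemma open_answer_set_iff_lfp_model:
  assumes strat: "stratified ar Ps"
  shows "open_answer_set ar (\<Union> (set Ps) \<union> edb_free_rules ar (\<Union> (set Ps))) U W \<longleftrightarrow>
    (\<exists>I. input_structure ar (\<Union> (set Ps)) U I \<and> lfp_model ar U Ps I W)"
proof -
  let ?P = "\<Union> (set Ps)"
  let ?strata = "\<forall>P\<in>set Ps. stratum_model ar U P W (restrict_preds W (preds P))"
  have lfp: "lfp_model ar U Ps I W \<longleftrightarrow> W \<subseteq> ground_atoms ar (preds ?P) U \<and>
      restrict_preds W (edb ?P) = I \<and> ?strata" if "I \<subseteq> ground_atoms ar (edb ?P) U" for I
    using lfp_model_iff[OF stratified_layered[OF strat] that]
    by (simp add: preds_edb_head_preds)
  have "open_answer_set ar (?P \<union> edb_free_rules ar ?P) U W \<longleftrightarrow>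
      universe ?P U \<and> W \<subseteq> ground_atoms ar (preds ?P) U \<and> ?strata"
    unfolding open_answer_set_def universe_Un_edb_free_rules preds_Un_edb_free_rules
    using answer_set_iff_strata[OF strat, of W U] by blast
  also have "\<dots> \<longleftrightarrow> (\<exists>I. input_structure ar ?P U I \<and> W \<subseteq> ground_atoms ar (preds ?P) U \<and>
      restrict_preds W (edb ?P) = I \<and> ?strata)"
    unfolding input_structure_def
    using restrict_preds_in_ground[of W ar "preds ?P" U "edb ?P"] by auto
  also have "\<dots> \<longleftrightarrow> (\<exists>I. input_structure ar ?P U I \<and> lfp_model ar U Ps I W)"
    by (intro ex_cong1 conj_cong refl) (simp add: lfp input_structure_def)
  finally show ?thesis .
qed

section \<open>Guardedness and size\<close>

lemma finite_genlit_atoms: "finite (genlit_atoms g)"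
proof -
  have "finite (set_bform \<phi>)" for \<phi> :: "('a, 'b) atom bform" by (induction \<phi>) auto
  then show ?thesis by (cases g) auto
qed

lemma finite_rule_atoms:
  assumes "datalog_rule ar r"
  shows "finite (rule_atoms r)"
proof -
  have "finite (set_literal l)" for l :: "('a, 'b) atom literal" by (cases l) auto
  then show ?thesis using assms finite_genlit_atoms
    by (auto simp: rule_atoms_def datalog_rule_def)
qed

lemma finite_atoms_preds:
  assumes "finite A"
  shows "finite (atoms_preds A)"
  using assms
proof induction
  case (insert a A)
  then show ?case by (cases a) auto
qed simp

text \<open>The single antecedent atom is itself the guard.\<close>

lemma lite_genlit_guarded: "lite_genlit g \<Longrightarrow> guarded_genlit g"
  by (cases g) auto

lemma stratified_finite: "stratified ar Ps \<Longrightarrow> finite (\<Union> (set Ps))"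
  by (auto simp: stratified_def basic_program_def)

lemma stratified_datalog_rule: "stratified ar Ps \<Longrightarrow> r \<in> \<Union> (set Ps) \<Longrightarrow> datalog_rule ar r"
  by (auto simp: stratified_def basic_program_def)

lemma stratified_finite_prog_atoms: "stratified ar Ps \<Longrightarrow> finite (prog_atoms (\<Union> (set Ps)))"
  unfolding prog_atoms_def
  using stratified_finite stratified_datalog_rule finite_rule_atoms by (metis finite_UN_I)

lemma stratified_finite_edb:
  assumes "stratified ar Ps"
  shows "finite (edb (\<Union> (set Ps)))"
  using finite_atoms_preds[OF stratified_finite_prog_atoms[OF assms]] by (simp add: edb_def preds_def)

text \<open>The rules of a Datalog LITEM program have a guard by definition, and the added rules are
  free and thus exempt from guardedness.\<close>

lemma ggP_Un_edb_free_rules: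
  assumes "datalog_litem ar Ps"
  shows "ggP ar (\<Union> (set Ps) \<union> edb_free_rules ar (\<Union> (set Ps)))"
proof -
  let ?P = "\<Union> (set Ps)"
  have strat: "stratified ar Ps" and guard: "\<forall>r\<in>?P. has_guard r"
    using assms by (auto simp: datalog_litem_def)
  note datalog = stratified_datalog_rule[OF strat]
  have "finite (?P \<union> edb_free_rules ar ?P)"
    using stratified_finite[OF strat] stratified_finite_edb[OF strat]
    by (simp add: edb_free_rules_def)
  moreover have "wf_atom ar a" if a: "a \<in> prog_atoms (?P \<union> edb_free_rules ar ?P)" for a
  proof -
    obtain r where r: "r \<in> ?P \<union> edb_free_rules ar ?P" "a \<in> rule_atoms r"
      using a unfolding prog_atoms_def by blast
    show ?thesis
    proof (cases "r \<in> ?P")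
      case True
      then show ?thesis using datalog r(2) unfolding datalog_rule_def by blast
    qed (use r in \<open>auto simp: edb_free_rules_def rule_atoms_edb_free_rule\<close>)
  qed
  moreover have "finite (head r) \<and> finite (lits r) \<and> finite (gens r) \<and> card (pos (head r)) \<le> 1 \<and>
      (\<forall>s t. Eq s t \<notin> pos (head r))" if "r \<in> ?P \<union> edb_free_rules ar ?P" for r
  proof (cases "r \<in> ?P")
    case True
    then show ?thesis using datalog[of r] by (auto simp: datalog_rule_def pos_def)
  qed (use that in \<open>auto simp: edb_free_rules_def pos_def\<close>)
  moreover have "guarded_rule r" if "r \<in> ?P" for r
    using datalog[OF that] guard that
    by (auto simp: guarded_rule_def datalog_rule_def intro: lite_genlit_guarded)
  moreover have "free_rule r" if "r \<in> edb_free_rules ar ?P" for r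
    using that by (auto simp: edb_free_rules_def free_rule_def edb_free_rule_def Let_def)
  ultimately show ?thesis unfolding ggP_def gP_def by blast
qed

section \<open>Linear size of the reduction\<close>

lemma sum_Un_le:
  fixes f :: "'a \<Rightarrow> nat"
  shows "sum f (A \<union> B) \<le> sum f A + sum f B"
  by (cases "finite A \<and> finite B") (auto simp: sum_Un_nat)

lemma sum_UN_le:
  fixes f :: "'a \<Rightarrow> nat"
  assumes "finite X"
  shows "sum f (\<Union> (A ` X)) \<le> (\<Sum>x\<in>X. sum f (A x))"
  using assms
proof induction
  case (insert x X)
  then show ?case using sum_Un_le[of f "A x" "\<Union> (A ` X)"] by simp
qed simp

text \<open>The left side counts each distinct atom once, the right side every occurrence.\<close>

lemma sum_atom_size_bform: "sum atom_size (set_bform \<phi>) \<le> bform_size \<phi>"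
proof (induction \<phi>)
  case (Conj \<phi> \<psi>)
  then show ?case using sum_Un_le[of atom_size "set_bform \<phi>" "set_bform \<psi>"] by simp
next
  case (Disj \<phi> \<psi>)
  then show ?case using sum_Un_le[of atom_size "set_bform \<phi>" "set_bform \<psi>"] by simp
qed auto

lemma sum_atom_size_genlit: "sum atom_size (genlit_atoms g) \<le> genlit_size g"
proof (cases g)
  case (GenLit Y \<phi> \<psi>)
  have "finite (set_bform \<phi>)" using finite_genlit_atoms[of g] GenLit by simp
  then have "sum atom_size (genlit_atoms g) \<le> atom_size \<psi> + sum atom_size (set_bform \<phi>)"
    using GenLit by (simp add: sum.insert_if)
  then show ?thesis using sum_atom_size_bform[of \<phi>] GenLit by simp
qed

lemma sum_atom_size_rule:
  assumes "datalog_rule ar r"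
  shows "sum atom_size (rule_atoms r) \<le> rule_size r"
proof -
  have fin: "finite (head r)" "finite (lits r)" "finite (gens r)"
    using assms by (auto simp: datalog_rule_def)
  have lit: "sum atom_size (\<Union> (set_literal ` L)) \<le> sum literal_size L"
    if "finite L" for L :: "('a, 'b) atom literal set"
  proof -
    have "sum atom_size (set_literal l) \<le> literal_size l" for l :: "('a, 'b) atom literal"
      by (cases l) auto
    then show ?thesis by (intro order_trans[OF sum_UN_le[OF that]] sum_mono)
  qed
  have gen: "sum atom_size (\<Union> (genlit_atoms ` gens r)) \<le> sum genlit_size (gens r)"
    by (intro order_trans[OF sum_UN_le[OF fin(3)]] sum_mono sum_atom_size_genlit)
  have "sum atom_size (rule_atoms r) \<le> sum atom_size (\<Union> (set_literal ` head r)) +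
      sum atom_size (\<Union> (set_literal ` lits r)) + sum atom_size (\<Union> (genlit_atoms ` gens r))"
    unfolding rule_atoms_def image_Un Union_Un_distrib by (meson sum_Un_le add_mono order_refl order_trans)
  then show ?thesis using lit[OF fin(1)] lit[OF fin(2)] gen by (simp add: rule_size_def)
qed

text \<open>Choose one atom of \<open>A\<close> for each predicate. Distinct predicates get distinct
  atoms, and by well-formedness the chosen atom has size one plus the arity.\<close>

lemma sum_arity_le_sum_atom_size:
  assumes "finite A" "\<forall>a\<in>A. wf_atom ar a"
  shows "(\<Sum>p\<in>atoms_preds A. Suc (ar p)) \<le> sum atom_size A"
proof -
  have "\<forall>p\<in>atoms_preds A. \<exists>b. (\<exists>ts. b = Reg p ts) \<and> b \<in> A"
    by (auto simp: atoms_preds_def)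
  then obtain a where a: "\<forall>p\<in>atoms_preds A. (\<exists>ts. a p = Reg p ts) \<and> a p \<in> A"
    by (auto dest: bchoice)
  then have inj: "inj_on a (atoms_preds A)" by (intro inj_onI) (metis atom.inject(1))
  have "(\<Sum>p\<in>atoms_preds A. Suc (ar p)) = (\<Sum>p\<in>atoms_preds A. atom_size (a p))"
  proof (rule sum.cong[OF refl])
    fix p assume "p \<in> atoms_preds A"
    then obtain ts where "a p = Reg p ts" "a p \<in> A" using a by blast
    moreover from this have "length ts = ar p" using assms(2) by fastforce
    ultimately show "Suc (ar p) = atom_size (a p)" by simp
  qed
  also have "\<dots> = sum atom_size (a ` atoms_preds A)" by (simp add: sum.reindex[OF inj])
  also have "\<dots> \<le> sum atom_size A" using assms(1) a by (intro sum_mono2) auto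
  finally show ?thesis .
qed

text \<open>The free rule of an n-ary predicate has size 2n + 4, at most 4(n + 1). Every extensional
  predicate occurs in an atom of the program, so the free rules cost at most four times the program
  size; the program itself accounts for the fifth.\<close>

lemma prog_size_Un_edb_free_rules:
  assumes strat: "stratified ar Ps"
  shows "prog_size (\<Union> (set Ps) \<union> edb_free_rules ar (\<Union> (set Ps))) \<le> 5 * prog_size (\<Union> (set Ps))"
proof -
  let ?P = "\<Union> (set Ps)"
  note datalog = stratified_datalog_rule[OF strat]
  note fin = stratified_finite[OF strat] stratified_finite_edb[OF strat]
  have wf: "\<forall>a\<in>prog_atoms ?P. wf_atom ar a"
    using datalog unfolding prog_atoms_def datalog_rule_def by blast
  have atoms: "sum atom_size (prog_atoms ?P) \<le> prog_size ?P"
    unfolding prog_atoms_def prog_size_def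
    using datalog by (intro order_trans[OF sum_UN_le[OF fin(1)]] sum_mono sum_atom_size_rule)
  have "inj_on (edb_free_rule ar :: _ \<Rightarrow> ('a, 'b) rule) (edb ?P)"
    by (intro inj_onI) (auto simp: edb_free_rule_def Let_def doubleton_eq_iff)
  then have "prog_size (edb_free_rules ar ?P) =
      (\<Sum>p\<in>edb ?P. rule_size (edb_free_rule ar p :: ('a, 'b) rule))"
    by (simp add: prog_size_def edb_free_rules_def sum.reindex)
  also have "\<dots> \<le> (\<Sum>p\<in>edb ?P. 4 * Suc (ar p))"
    by (intro sum_mono) (simp add: rule_size_def)
  also have "\<dots> \<le> 4 * (\<Sum>p\<in>preds ?P. Suc (ar p))"
    unfolding sum_distrib_left[symmetric] preds_def
    using finite_atoms_preds[OF stratified_finite_prog_atoms[OF strat]]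
    by (intro mult_left_mono sum_mono2) (auto simp: edb_def preds_def)
  also have "\<dots> \<le> 4 * prog_size ?P"
    using sum_arity_le_sum_atom_size[OF stratified_finite_prog_atoms[OF strat] wf] atoms
    by (simp add: preds_def)
  finally have "prog_size (edb_free_rules ar ?P) \<le> 4 * prog_size ?P" .
  moreover have "prog_size (?P \<union> edb_free_rules ar ?P) \<le>
      prog_size ?P + prog_size (edb_free_rules ar ?P)"
    using fin by (simp add: prog_size_def edb_free_rules_def sum_Un_nat)
  ultimately show ?thesis by simp
qed

theorem theorem8p9:
  shows "(\<forall>(ar :: 'p \<Rightarrow> nat) (Ps :: ('p, 'c::infinite) program list) q.
            datalog_litem_query ar Ps q \<longrightarrow>
            (let P = \<Union> (set Ps); P' = P \<union> edb_free_rules ar P in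
             ggP ar P' \<and> (query_satisfiable ar Ps q \<longleftrightarrow> satisfiable ar P' q))) \<and>
         (\<exists>c :: nat. \<forall>(ar :: 'p \<Rightarrow> nat) (Ps :: ('p, 'c) program list).
            datalog_litem ar Ps \<longrightarrow>
            (let P = \<Union> (set Ps) in prog_size (P \<union> edb_free_rules ar P) \<le> c * prog_size P))"
proof (intro conjI allI impI)
  fix ar :: "'p \<Rightarrow> nat" and Ps :: "('p, 'c) program list" and q
  assume "datalog_litem_query ar Ps q"
  then have litem: "datalog_litem ar Ps" by (simp add: datalog_litem_query_def)
  then have strat: "stratified ar Ps" by (simp add: datalog_litem_def)
  have "query_satisfiable ar Ps q \<longleftrightarrow> satisfiable ar (\<Union> (set Ps) \<union> edb_free_rules ar (\<Union> (set Ps))) q"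
    unfolding query_satisfiable_def satisfiable_def open_answer_set_iff_lfp_model[OF strat] by blast
  then show "let P = \<Union> (set Ps); P' = P \<union> edb_free_rules ar P in
      ggP ar P' \<and> (query_satisfiable ar Ps q \<longleftrightarrow> satisfiable ar P' q)"
    using ggP_Un_edb_free_rules[OF litem] by (simp add: Let_def)
next
  \<comment> \<open>The constant is 5, uniformly in the arities and the program.\<close>
  show "\<exists>c :: nat. \<forall>(ar :: 'p \<Rightarrow> nat) (Ps :: ('p, 'c) program list). datalog_litem ar Ps \<longrightarrow>
      (let P = \<Union> (set Ps) in prog_size (P \<union> edb_free_rules ar P) \<le> c * prog_size P)"
    using prog_size_Un_edb_free_rules unfolding Let_def datalog_litem_def by blast
qed

end
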